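(* There are exactly four isometry classes of icosahedra (with all edge lengths $1$) such that, for every pair of combinatorially opposite vertices, the midpoint of the two vertices is the center of mass of the icosahedron (i.e. $V_i+V_{d(i)}=0$ for all $i\in\{1,\dots,12\}$).
   Context: Let $a,b,c,d$ be the permutations of $\{1,\dots,12\}$ $a=(1,2)(3,4)(5,7)(6,8)(9,11)(10,12)$, $b=(1,10)(3,9)(2,12)(4,11)(5,6)(7,8)$, $c=(1,7)(2,3)(4,11)(5,12)(6,8)(9,10)$, $d=(1,12)(3,9)(2,10)(4,11)(5,7)(6,8)$. The group $A=\langle a,b,c,d\rangle\cong C_2\times A_5$ of order 120 is the combinatorial automorphism group of the abstract icosahedron with vertex set $\{1,\dots,12\}$; $d$ generates its center and interchanges combinatorially opposite vertices. The 20 triangles are the sets in the $A$-orbit of $\{1,2,3\}$ and the 30 edges are the sets in the $A$-orbit of $\{1,2\}$. An icosahedron is a tuple of pairwise distinct points $V_1,\dots,V_{12}\in\mathbb{R}^3$ with $\|V_i-V_j\|=1$ for each of the 30 edges $\{i,j\}$ and $V_1+\dots+V_{12}=0$ (so the origin is the center of mass; self-intersections are allowed). Its coordinate matrix is the $3\times 12$-matrix $M$ with columns $V_1,\dots,V_{12}$ and its Gram-matrix is $G=M^{tr}M$. For $g\in A$ let $\pi(g)$ be the permutation matrix with $\pi(g)e_i=e_{g(i)}$; $A$ acts on the set of Gram-matrices of icosahedra by $G\mapsto \pi(g)^{tr}G\,\pi(g)$. Two icosahedra are isometric (equivalent, isomorphic) if their Gram-matrices lie in the same $A$-orbit. *)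

theory Defs
  imports "HOL-Analysis.Analysis" "HOL-Algebra.Bij" "HOL-Algebra.Generated_Groups"
begin

text \<open>
  The vertices are the elements of the type \<^typ>\<open>12\<close> (integers modulo 12), whose twelve
  distinct elements are the numerals 1, ..., 12; note that 12 = 0 in this type.
\<close>

type_synonym vertex = 12

abbreviation swap :: "vertex \<Rightarrow> vertex \<Rightarrow> vertex \<Rightarrow> vertex"
  where "swap \<equiv> Transposition.transpose"

definition perm_a :: "vertex \<Rightarrow> vertex" where
  "perm_a = swap 1 2 \<circ> swap 3 4 \<circ> swap 5 7 \<circ> swap 6 8 \<circ> swap 9 11 \<circ> swap 10 12"

definition perm_b :: "vertex \<Rightarrow> vertex" where
  "perm_b = swap 1 10 \<circ> swap 3 9 \<circ> swap 2 12 \<circ> swap 4 11 \<circ> swap 5 6 \<circ> swap 7 8"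

definition perm_c :: "vertex \<Rightarrow> vertex" where
  "perm_c = swap 1 7 \<circ> swap 2 3 \<circ> swap 4 11 \<circ> swap 5 12 \<circ> swap 6 8 \<circ> swap 9 10"

definition perm_d :: "vertex \<Rightarrow> vertex" where
  "perm_d = swap 1 12 \<circ> swap 3 9 \<circ> swap 2 10 \<circ> swap 4 11 \<circ> swap 5 7 \<circ> swap 6 8"

definition ico_group :: "(vertex \<Rightarrow> vertex) set" where
  "ico_group = generate (BijGroup UNIV) {perm_a, perm_b, perm_c, perm_d}"

definition ico_edges :: "vertex set set" where
  "ico_edges = {g ` {1, 2} | g. g \<in> ico_group}"

definition icosahedra :: "(vertex \<Rightarrow> real ^ 3) set" where
  "icosahedra = {V. inj V \<and> (\<forall>i j. {i, j} \<in> ico_edges \<longrightarrow> norm (V i - V j) = 1) \<and> (\<Sum>i\<in>UNIV. V i) = 0}"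

definition coord_matrix :: "(vertex \<Rightarrow> real ^ 3) \<Rightarrow> real ^ vertex ^ 3" where
  "coord_matrix V = (\<chi> k i. V i $ k)"

definition gram_matrix :: "(vertex \<Rightarrow> real ^ 3) \<Rightarrow> real ^ vertex ^ vertex" where
  "gram_matrix V =
     Finite_Cartesian_Product.transpose (coord_matrix V) ** coord_matrix V"

text \<open>Column \<open>i\<close> of the permutation matrix of \<open>g\<close> is the unit vector with index \<open>g i\<close>.\<close>

definition perm_matrix :: "(vertex \<Rightarrow> vertex) \<Rightarrow> real ^ vertex ^ vertex" where
  "perm_matrix g = (\<chi> k i. if k = g i then 1 else 0)"

definition gram_action :: "(vertex \<Rightarrow> vertex) \<Rightarrow> real ^ vertex ^ vertex \<Rightarrow> real ^ vertex ^ vertex" where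
  "gram_action g G = Finite_Cartesian_Product.transpose (perm_matrix g) ** G ** perm_matrix g"

definition isometry_rel :: "((vertex \<Rightarrow> real ^ 3) \<times> (vertex \<Rightarrow> real ^ 3)) set" where
  "isometry_rel = {(V, W). V \<in> icosahedra \<and> W \<in> icosahedra \<and>
     (\<exists>g\<in>ico_group. gram_matrix W = gram_action g (gram_matrix V))}"

end

theory Submission
  imports Defs
begin

text \<open>
  A centrally symmetric icosahedron consists of six vectors up to sign, one for each axis; any two of
  them, with suitable signs, differ by a unit vector. Hence the squared norms of the six vectors
  determine the Gram matrix, and the claim is that only four patterns of norms occur up to symmetry.

  Split the six axes into the three pairs \<open>(a, p0)\<close>, \<open>(p1, p4)\<close>, \<open>(p2, p3)\<close>, where \<open>p0, \<dots>, p4\<close> are the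
  neighbours of \<open>a\<close> in cyclic order. The sums and differences within the pairs contain three
  orthogonal frames of \<open>\<real>\<^sup>3\<close>, permuted cyclically. Expanding vectors of one frame in another
  gives polynomial equations from which it follows that the norms differ in at most one of the three
  pairs. Rotating the pentagon yields five splittings that together contain every pair of axes
  exactly once, so at most five of the fifteen pairs have different norms, and therefore five of the
  six norms agree. The common value is a root of a quadratic equation, and for each root there are two
  possibilities for the sixth norm. The four patterns are realised by the regular icosahedron, the
  great icosahedron, and the results of reflecting one pair of opposite vertices of either one in the
  planes spanned by their neighbours.
\<close>

subsection \<open>The automorphism group\<close>

text \<open>Reduction modulo 12 lets the simplifier decide whether two numerals name the same
  vertex; the finite checks below rest on this.\<close>

lemma vertex_numeral_eq_iff [simp]:
  "(numeral m :: vertex) = numeral n \<longleftrightarrow> (numeral m :: int) mod 12 = numeral n mod 12"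
  using Rep_bit0_inject[of "numeral m :: vertex" "numeral n"]
  by (simp add: bit0.Rep_numeral)

lemma vertex_numeral_eq_one_iff [simp]:
  "(numeral m :: vertex) = 1 \<longleftrightarrow> (numeral m :: int) mod 12 = 1"
  "(1 :: vertex) = numeral m \<longleftrightarrow> (numeral m :: int) mod 12 = 1"
  using vertex_numeral_eq_iff[of m Num.One] vertex_numeral_eq_iff[of Num.One m] by auto

lemma UNIV_vertex: "(UNIV :: vertex set) = {1, 2, 3, 4, 5, 6, 7, 8, 9, 10, 11, 12}"
proof (rule sym, rule card_subset_eq)
  show "card {1, 2, 3, 4, 5, 6, 7, 8, 9, 10, 11, 12 :: vertex} = card (UNIV :: vertex set)"
    by simp
qed simp_all

lemma all_vertex:
  "(\<forall>i::vertex. P i) \<longleftrightarrow> P 1 \<and> P 2 \<and> P 3 \<and> P 4 \<and> P 5 \<and> P 6 \<and> P 7 \<and> P 8 \<and> P 9 \<and> P 10 \<and> P 11 \<and> P 12"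
proof -
  have "(\<forall>i::vertex. P i) \<longleftrightarrow> (\<forall>i\<in>{1, 2, 3, 4, 5, 6, 7, 8, 9, 10, 11, 12 :: vertex}. P i)"
    using UNIV_vertex by (metis UNIV_I)
  then show ?thesis by simp
qed

lemma perm_a [simp]:
  "perm_a 1 = 2" "perm_a 2 = 1" "perm_a 3 = 4" "perm_a 4 = 3" "perm_a 5 = 7" "perm_a 7 = 5"
  "perm_a 6 = 8" "perm_a 8 = 6" "perm_a 9 = 11" "perm_a 11 = 9" "perm_a 10 = 12" "perm_a 12 = 10"
  by (simp_all add: perm_a_def Transposition.transpose_def)

lemma perm_b [simp]:
  "perm_b 1 = 10" "perm_b 10 = 1" "perm_b 3 = 9" "perm_b 9 = 3" "perm_b 2 = 12" "perm_b 12 = 2"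
  "perm_b 4 = 11" "perm_b 11 = 4" "perm_b 5 = 6" "perm_b 6 = 5" "perm_b 7 = 8" "perm_b 8 = 7"
  by (simp_all add: perm_b_def Transposition.transpose_def)

lemma perm_c [simp]:
  "perm_c 1 = 7" "perm_c 7 = 1" "perm_c 2 = 3" "perm_c 3 = 2" "perm_c 4 = 11" "perm_c 11 = 4"
  "perm_c 5 = 12" "perm_c 12 = 5" "perm_c 6 = 8" "perm_c 8 = 6" "perm_c 9 = 10" "perm_c 10 = 9"
  by (simp_all add: perm_c_def Transposition.transpose_def)

lemma perm_d [simp]:
  "perm_d 1 = 12" "perm_d 12 = 1" "perm_d 3 = 9" "perm_d 9 = 3" "perm_d 2 = 10" "perm_d 10 = 2"
  "perm_d 4 = 11" "perm_d 11 = 4" "perm_d 5 = 7" "perm_d 7 = 5" "perm_d 6 = 8" "perm_d 8 = 6"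
  by (simp_all add: perm_d_def Transposition.transpose_def)

lemma generators_involution [simp]:
  "perm_a (perm_a i) = i" "perm_b (perm_b i) = i" "perm_c (perm_c i) = i" "perm_d (perm_d i) = i"
proof -
  have "\<forall>i. perm_a (perm_a i) = i" "\<forall>i. perm_b (perm_b i) = i"
    "\<forall>i. perm_c (perm_c i) = i" "\<forall>i. perm_d (perm_d i) = i"
    unfolding all_vertex by simp_all
  then show "perm_a (perm_a i) = i" "perm_b (perm_b i) = i" "perm_c (perm_c i) = i"
    "perm_d (perm_d i) = i"
    by blast+
qed

lemma generators_commute_perm_d:
  "perm_a (perm_d i) = perm_d (perm_a i)" "perm_b (perm_d i) = perm_d (perm_b i)"
  "perm_c (perm_d i) = perm_d (perm_c i)"
proof -
  have "\<forall>i. perm_a (perm_d i) = perm_d (perm_a i)" "\<forall>i. perm_b (perm_d i) = perm_d (perm_b i)"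
    "\<forall>i. perm_c (perm_d i) = perm_d (perm_c i)"
    unfolding all_vertex by simp_all
  then show "perm_a (perm_d i) = perm_d (perm_a i)" "perm_b (perm_d i) = perm_d (perm_b i)"
    "perm_c (perm_d i) = perm_d (perm_c i)"
    by blast+
qed

lemma bij_generators: "bij perm_a" "bij perm_b" "bij perm_c" "bij perm_d"
  by (rule involuntory_imp_bij; simp)+

section \<open>The generated group as a group of bijections\<close>

lemma generators_subset: "{perm_a, perm_b, perm_c, perm_d} \<subseteq> carrier (BijGroup UNIV)"
  using bij_generators by (simp add: BijGroup_def Bij_def)

lemma mult_BijGroup_UNIV:
  "f \<in> carrier (BijGroup UNIV) \<Longrightarrow> g \<in> carrier (BijGroup UNIV) \<Longrightarrow>
    f \<otimes>\<^bsub>BijGroup UNIV\<^esub> g = f \<circ> g"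
  by (auto simp: BijGroup_def fun_eq_iff compose_def)

lemma subgroup_ico_group: "subgroup ico_group (BijGroup UNIV)"
  unfolding ico_group_def using generators_subset by (rule group.generate_is_subgroup[OF group_BijGroup])

lemma ico_group_carrier: "g \<in> ico_group \<Longrightarrow> g \<in> carrier (BijGroup UNIV)"
  using subgroup.subset[OF subgroup_ico_group] by (rule subsetD)

lemma ico_group_comp: "f \<in> ico_group \<Longrightarrow> g \<in> ico_group \<Longrightarrow> f \<circ> g \<in> ico_group"
  using subgroup.m_closed[OF subgroup_ico_group, of f g]
  by (simp add: mult_BijGroup_UNIV ico_group_carrier)

lemma ico_group_id: "id \<in> ico_group"
proof -
  have "\<one>\<^bsub>BijGroup (UNIV :: vertex set)\<^esub> = id" by (simp add: BijGroup_def fun_eq_iff)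
  with subgroup.one_closed[OF subgroup_ico_group] show ?thesis by simp
qed

lemma ico_group_bij: "g \<in> ico_group \<Longrightarrow> bij g"
  using subgroup.subset[OF subgroup_ico_group] by (auto simp: BijGroup_def Bij_def)

lemma ico_group_inverse:
  assumes "g \<in> ico_group"
  shows "inv_into UNIV g \<in> ico_group"
proof -
  have "inv\<^bsub>BijGroup UNIV\<^esub> g = inv_into UNIV g"
    using assms subgroup.subset[OF subgroup_ico_group]
    by (subst inv_BijGroup) (auto simp: BijGroup_def)
  with subgroup.m_inv_closed[OF subgroup_ico_group assms] show ?thesis by simp
qed

lemma ico_group_generators:
  "perm_a \<in> ico_group" "perm_b \<in> ico_group" "perm_c \<in> ico_group" "perm_d \<in> ico_group"
  unfolding ico_group_def by (auto intro: generate.incl)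

text \<open>The generators are involutions, so every element is a product of generators without
  inverses.\<close>

lemma ico_group_induct [consumes 1, case_names id a b c d]:
  assumes "g \<in> ico_group"
    and "P id"
    and "\<And>g. g \<in> ico_group \<Longrightarrow> P g \<Longrightarrow> P (perm_a \<circ> g)"
    and "\<And>g. g \<in> ico_group \<Longrightarrow> P g \<Longrightarrow> P (perm_b \<circ> g)"
    and "\<And>g. g \<in> ico_group \<Longrightarrow> P g \<Longrightarrow> P (perm_c \<circ> g)"
    and "\<And>g. g \<in> ico_group \<Longrightarrow> P g \<Longrightarrow> P (perm_d \<circ> g)"
  shows "P g"
proof -
  have inv_gen: "inv\<^bsub>BijGroup UNIV\<^esub> h = h" if "h \<in> {perm_a, perm_b, perm_c, perm_d}" for h
  proof (rule group.inv_equality[OF group_BijGroup])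
    show "h \<otimes>\<^bsub>BijGroup UNIV\<^esub> h = \<one>\<^bsub>BijGroup UNIV\<^esub>"
      using that generators_subset
      by (subst mult_BijGroup_UNIV) (auto simp: BijGroup_def comp_def)
  qed (use that generators_subset in auto)
  have gen: "\<forall>k. P k \<longrightarrow> k \<in> ico_group \<longrightarrow> h \<in> ico_group \<and> P (h \<circ> k)"
    if "h \<in> {perm_a, perm_b, perm_c, perm_d}" for h
    using that assms(3-6) ico_group_generators by (metis insertE singletonD)
  \<comment> \<open>Quantifying over all \<open>k\<close> turns the product in case
    \<open>eng\<close> into two successive left multiplications.\<close>
  have *: "\<forall>k. P k \<longrightarrow> k \<in> ico_group \<longrightarrow> h \<in> ico_group \<and> P (h \<circ> k)"
    if "h \<in> generate (BijGroup UNIV) {perm_a, perm_b, perm_c, perm_d}" for h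
    using that
  proof induction
    case one
    have "\<one>\<^bsub>BijGroup (UNIV :: vertex set)\<^esub> = (\<lambda>x. x)" by (simp add: BijGroup_def fun_eq_iff)
    then show ?case using ico_group_id by (simp add: id_def)
  next
    case (incl h)
    then show ?case by (rule gen)
  next
    case (inv h)
    then show ?case using gen inv_gen by metis
  next
    case (eng h1 h2)
    have "h1 \<otimes>\<^bsub>BijGroup UNIV\<^esub> h2 = h1 \<circ> h2"
      using eng(1,2) group.generate_incl[OF group_BijGroup generators_subset]
      by (intro mult_BijGroup_UNIV) auto
    then show ?case using eng(3,4) ico_group_comp by (metis comp_assoc)
  qed
  from * [of g] assms(1,2) ico_group_id show ?thesis by (auto simp: ico_group_def)
qed

subsection \<open>Edges\<close>

lemma ico_edges_image_ico_group:
  assumes "g \<in> ico_group" "e \<in> ico_edges"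
  shows "g ` e \<in> ico_edges"
proof -
  obtain k where "k \<in> ico_group" "e = k ` {1, 2}" using assms(2) unfolding ico_edges_def by blast
  then have "g \<circ> k \<in> ico_group" "g ` e = (g \<circ> k) ` {1, 2}"
    using ico_group_comp[OF assms(1)] by (simp_all add: image_comp)
  then show ?thesis unfolding ico_edges_def by blast
qed

lemmas ico_edges_image = ico_group_generators[THEN ico_edges_image_ico_group]

text \<open>The list is stable under the generators and so contains the orbit. Conversely, each
  listed edge arises by a generator from \<open>{1, 2}\<close> or an edge already obtained.\<close>

lemma ico_edges_eq:
  "ico_edges = {{1, 2}, {10, 12}, {7, 3}, {9, 5}, {5, 4}, {8, 9}, {11, 7}, {3, 6}, {6, 11}, {12, 11}, {6,
    10}, {4, 8}, {4, 1}, {2, 8}, {10, 9}, {2, 4}, {8, 12}, {5, 1}, {3, 2}, {11, 10}, {1, 6},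
    {12, 7}, {1, 3}, {3, 11}, {7, 2}, {6, 5}, {9, 12}, {4, 9}, {10, 5}, {7, 8}}" (is "_ = ?E")
proof
  have closed: "\<forall>e\<in>?E. perm_a ` e \<in> ?E" "\<forall>e\<in>?E. perm_b ` e \<in> ?E"
    "\<forall>e\<in>?E. perm_c ` e \<in> ?E" "\<forall>e\<in>?E. perm_d ` e \<in> ?E"
    by (simp_all add: doubleton_eq_iff)
  define E where "E = ?E"
  note closed = closed[folded E_def]
  have "g ` {1, 2} \<in> E" if "g \<in> ico_group" for g
    using that
  proof (induction rule: ico_group_induct)
    case id
    show ?case by (simp add: E_def)
  qed (use closed in \<open>auto simp only: image_comp[symmetric]\<close>)
  then show "ico_edges \<subseteq> ?E" unfolding ico_edges_def E_def[symmetric] by blast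
next
  have "id ` {1, 2} \<in> ico_edges" unfolding ico_edges_def using ico_group_id by blast
  then have e1_2: "{1, 2} \<in> ico_edges" by simp
  have e10_12: "{10, 12} \<in> ico_edges" using ico_edges_image(2)[OF e1_2] by simp
  have e7_3: "{7, 3} \<in> ico_edges" using ico_edges_image(3)[OF e1_2] by simp
  have e9_5: "{9, 5} \<in> ico_edges" using ico_edges_image(3)[OF e10_12] by simp
  have e5_4: "{5, 4} \<in> ico_edges" using ico_edges_image(1)[OF e7_3] by simp
  have e8_9: "{8, 9} \<in> ico_edges" using ico_edges_image(2)[OF e7_3] by simp
  have e11_7: "{11, 7} \<in> ico_edges" using ico_edges_image(1)[OF e9_5] by simp
  have e3_6: "{3, 6} \<in> ico_edges" using ico_edges_image(2)[OF e9_5] by simp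
  have e6_11: "{6, 11} \<in> ico_edges" using ico_edges_image(2)[OF e5_4] by simp
  have e12_11: "{12, 11} \<in> ico_edges" using ico_edges_image(3)[OF e5_4] by simp
  have e6_10: "{6, 10} \<in> ico_edges" using ico_edges_image(3)[OF e8_9] by simp
  have e4_8: "{4, 8} \<in> ico_edges" using ico_edges_image(2)[OF e11_7] by simp
  have e4_1: "{4, 1} \<in> ico_edges" using ico_edges_image(3)[OF e11_7] by simp
  have e2_8: "{2, 8} \<in> ico_edges" using ico_edges_image(3)[OF e3_6] by simp
  have e10_9: "{10, 9} \<in> ico_edges" using ico_edges_image(1)[OF e12_11] by simp
  have e2_4: "{2, 4} \<in> ico_edges" using ico_edges_image(2)[OF e12_11] by simp
  have e8_12: "{8, 12} \<in> ico_edges" using ico_edges_image(1)[OF e6_10] by simp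
  have e5_1: "{5, 1} \<in> ico_edges" using ico_edges_image(2)[OF e6_10] by simp
  have e3_2: "{3, 2} \<in> ico_edges" using ico_edges_image(1)[OF e4_1] by simp
  have e11_10: "{11, 10} \<in> ico_edges" using ico_edges_image(2)[OF e4_1] by simp
  have e1_6: "{1, 6} \<in> ico_edges" using ico_edges_image(1)[OF e2_8] by simp
  have e12_7: "{12, 7} \<in> ico_edges" using ico_edges_image(2)[OF e2_8] by simp
  have e1_3: "{1, 3} \<in> ico_edges" using ico_edges_image(2)[OF e10_9] by simp
  have e3_11: "{3, 11} \<in> ico_edges" using ico_edges_image(3)[OF e2_4] by simp
  have e7_2: "{7, 2} \<in> ico_edges" using ico_edges_image(2)[OF e8_12] by simp
  have e6_5: "{6, 5} \<in> ico_edges" using ico_edges_image(3)[OF e8_12] by simp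
  have e9_12: "{9, 12} \<in> ico_edges" using ico_edges_image(2)[OF e3_2] by simp
  have e4_9: "{4, 9} \<in> ico_edges" using ico_edges_image(3)[OF e11_10] by simp
  have e10_5: "{10, 5} \<in> ico_edges" using ico_edges_image(2)[OF e1_6] by simp
  have e7_8: "{7, 8} \<in> ico_edges" using ico_edges_image(3)[OF e1_6] by simp
  show "?E \<subseteq> ico_edges"
    by (simp only: insert_subset empty_subsetI simp_thms
      e1_2 e10_12 e7_3 e9_5 e5_4 e8_9 e11_7 e3_6 e6_11 e12_11 e6_10 e4_8 e4_1 e2_8 e10_9 e2_4
    e8_12 e5_1 e3_2 e11_10 e1_6 e12_7 e1_3 e3_11 e7_2 e6_5 e9_12 e4_9 e10_5 e7_8)
qed

section \<open>Transitivity and the relative position of two vertices\<close>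

lemma ico_group_transitive: "\<exists>g\<in>ico_group. g i = j"
proof -
  have step: "\<exists>g\<in>ico_group. g 1 = h j" if "\<exists>g\<in>ico_group. g 1 = j" "h \<in> ico_group" for h j
    using that ico_group_comp by (metis comp_apply)
  have 1: "\<exists>g\<in>ico_group. g 1 = 1" using ico_group_id by (intro bexI[of _ id]) simp_all
  note a = step[OF _ ico_group_generators(1)] and b = step[OF _ ico_group_generators(2)]
    and c = step[OF _ ico_group_generators(3)] and d = step[OF _ ico_group_generators(4)]
  note 2 = a[OF 1, simplified] and 7 = c[OF 1, simplified] and 10 = b[OF 1, simplified]
    and 12 = d[OF 1, simplified]
  note 3 = c[OF 2, simplified] and 5 = a[OF 7, simplified] and 8 = b[OF 7, simplified]
  note 4 = a[OF 3, simplified] and 6 = a[OF 8, simplified] and 9 = b[OF 3, simplified]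
  note 11 = a[OF 9, simplified]
  have from_1: "\<forall>j. \<exists>g\<in>ico_group. g 1 = j"
    unfolding all_vertex by (intro conjI 1 2 3 4 5 6 7 8 9 10 11 12)
  then obtain g h where g: "g \<in> ico_group" "g 1 = i" and h: "h \<in> ico_group" "h 1 = j" by metis
  have "(h \<circ> inv_into UNIV g) i = j"
    using g h ico_group_bij[OF g(1)] by (metis bij_inv_eq_iff comp_apply)
  then show ?thesis using ico_group_comp[OF h(1) ico_group_inverse[OF g(1)]] by blast
qed

lemma ico_group_commute_perm_d:
  assumes "g \<in> ico_group"
  shows "g (perm_d i) = perm_d (g i)"
  using assms by (induction rule: ico_group_induct) (simp_all add: generators_commute_perm_d)

lemma ico_edges_ico_group:
  assumes "g \<in> ico_group"
  shows "{g i, g j} \<in> ico_edges \<longleftrightarrow> {i, j} \<in> ico_edges"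
proof -
  have *: "{h i, h j} \<in> ico_edges" if "{i, j} \<in> ico_edges" "h \<in> ico_group" for h i j
    using ico_edges_image_ico_group[OF that(2,1)] by simp
  have "inv_into UNIV g (g x) = x" for x using ico_group_bij[OF assms] by (simp add: bij_is_inj)
  then show ?thesis
    using *[of "g i" "g j" "inv_into UNIV g"] *[of i j g] ico_group_inverse[OF assms] assms by auto
qed

text \<open>A vertex has five neighbours, and the opposites of these are the other five vertices off
  its axis. Transitivity and the centrality of \<open>perm_d\<close> reduce the check to vertex
  1.\<close>

lemma vertex_pair_cases: "j = i \<or> j = perm_d i \<or> {i, j} \<in> ico_edges \<or> {i, perm_d j} \<in> ico_edges"
proof -
  have *: "\<forall>j. j = 1 \<or> j = perm_d 1 \<or> {1, j} \<in> ico_edges \<or> {1, perm_d j} \<in> ico_edges"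
    unfolding all_vertex ico_edges_eq by (simp add: doubleton_eq_iff)
  obtain g where g: "g \<in> ico_group" "g 1 = i" using ico_group_transitive by blast
  obtain k where "j = g k" using ico_group_bij[OF g(1)] by (metis bij_pointE)
  then show ?thesis
    using *[rule_format, of k] g ico_group_commute_perm_d[OF g(1)] ico_edges_ico_group[OF g(1)] by metis
qed

subsection \<open>Three linked orthogonal frames\<close>

text \<open>Parseval's identity for an orthogonal frame that is not normalised. With denominators
  cleared it stays true when a frame vector vanishes.\<close>

lemma orthogonal_frame_inner:
  fixes u v w x y :: "real ^ 3"
  assumes "u \<bullet> v = 0" "u \<bullet> w = 0" "v \<bullet> w = 0"
  shows "(x \<bullet> y) * (u \<bullet> u) * (v \<bullet> v) * (w \<bullet> w) =
    (x \<bullet> u) * (y \<bullet> u) * (v \<bullet> v) * (w \<bullet> w) + (x \<bullet> v) * (y \<bullet> v) * (u \<bullet> u) * (w \<bullet> w) +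
    (x \<bullet> w) * (y \<bullet> w) * (u \<bullet> u) * (v \<bullet> v)"
proof (cases "u = 0 \<or> v = 0 \<or> w = 0")
  case False
  then have nz: "u \<noteq> 0" "v \<noteq> 0" "w \<noteq> 0" by auto
  \<comment> \<open>\<open>z\<close> is what remains of \<open>x\<close> after projection to the
    three axes; being orthogonal to a spanning set, it is zero.\<close>
  define z where "z = x - ((x \<bullet> u) / (u \<bullet> u)) *\<^sub>R u - ((x \<bullet> v) / (v \<bullet> v)) *\<^sub>R v - ((x \<bullet> w) / (w \<bullet> w)) *\<^sub>R w"
  have ne: "u \<noteq> v" "u \<noteq> w" "v \<noteq> w" using assms nz by auto
  have "pairwise orthogonal {u, v, w}"
    using assms by (auto simp: pairwise_insert orthogonal_def inner_commute)
  then have "independent {u, v, w}" using nz by (intro pairwise_orthogonal_independent) auto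
  then have "UNIV \<subseteq> span {u, v, w}"
    by (rule card_ge_dim_independent[OF subset_UNIV]) (use ne in \<open>simp add: dim_UNIV\<close>)
  moreover have "orthogonal z a" if "a \<in> {u, v, w}" for a
    using that assms nz by (auto simp: z_def orthogonal_def inner_diff_left inner_diff_right inner_commute)
  ultimately have "orthogonal z z" by (intro orthogonal_to_span[of z "{u, v, w}"]) auto
  then have "z = 0" by (simp add: orthogonal_def)
  then have "z \<bullet> y = 0" by simp
  then have "x \<bullet> y = (x \<bullet> u) / (u \<bullet> u) * (u \<bullet> y) + (x \<bullet> v) / (v \<bullet> v) * (v \<bullet> y) + (x \<bullet> w) / (w \<bullet> w) * (w \<bullet> y)"
    by (simp add: z_def inner_diff_left)
  with nz show ?thesis by (simp add: field_simps inner_commute)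
qed auto

text \<open>
  The nine assumptions of the next two lemmas are those obtained below in \<open>linked_frames.elimination\<close>.
  The cofactors in the proofs were found by solving linear equations for their coefficients.
\<close>

lemma cyclic_quadratic:
  fixes b1 b2 b3 :: real
  assumes "(3-b2)*(b3*b1+b1*b2-3*b1-3*b2+6) + b1*b2*(3-b1)*(4*b1+3*b2+3*b3-b1*b2-b2*b3-10) = 0" (is "?I1 = 0")
    and "(3-b3)*(b1*b2+b2*b3-3*b2-3*b3+6) + b2*b3*(3-b2)*(4*b2+3*b3+3*b1-b2*b3-b3*b1-10) = 0" (is "?I2 = 0")
    and "(3-b1)*(b2*b3+b3*b1-3*b3-3*b1+6) + b3*b1*(3-b3)*(4*b3+3*b1+3*b2-b3*b1-b1*b2-10) = 0" (is "?I3 = 0")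
    and "b3*(b3*b1+b1*b2-3*b1-3*b2+6) + b1*(3-b1)*(3-b3)*(3*b3-b1-b2*b3-b3*b1+2) = 0" (is "?J1 = 0")
    and "b1*(b1*b2+b2*b3-3*b2-3*b3+6) + b2*(3-b2)*(3-b1)*(3*b1-b2-b3*b1-b1*b2+2) = 0" (is "?J2 = 0")
    and "b2*(b2*b3+b3*b1-3*b3-3*b1+6) + b3*(3-b3)*(3-b2)*(3*b2-b3-b1*b2-b2*b3+2) = 0" (is "?J3 = 0")
    and "b2*b3*(4*b1+3*b2+3*b3-b1*b2-b2*b3-10) - (3-b2)*(3-b3)*(3*b3-b1-b2*b3-b3*b1+2) = 0" (is "?K1 = 0")
    and "b3*b1*(4*b2+3*b3+3*b1-b2*b3-b3*b1-10) - (3-b3)*(3-b1)*(3*b1-b2-b3*b1-b1*b2+2) = 0" (is "?K2 = 0")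
    and "b1*b2*(4*b3+3*b1+3*b2-b3*b1-b1*b2-10) - (3-b1)*(3-b2)*(3*b2-b3-b1*b2-b2*b3+2) = 0" (is "?K3 = 0")
  shows "b1^2 - b3^2 - 2*b1 - 2*b2 + 4*b3 = 0"
proof -
  have "72 * (b1^2 - b3^2 - 2*b1 - 2*b2 + 4*b3) =
    (- 3*b1*b2 + b1*b3 + b2*b3 - b3^2 + 8*b1 + 13*b2 - 5*b3 - 1)*?K1 +
    (- 4*b2*b3^2 - 6*b1*b3 + 18*b2*b3 + 12*b3^2 - 6*b1 - 7*b2 - 18*b3 - 3)*?K2 +
    (- 6*b2*b3 + 6*b2 + 5*b3 + 6)*?K3 +
    (2*b2*b3^2 + 2*b3^3 - 8*b2*b3 - 7*b3^2 + 6*b2 + 10*b3 - 21)*?I1 +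
    (b3 - b3^2 - 10)*?I2 +
    (2*b2^3 + 2*b2^2*b3 - 22*b2^2 - 6*b2*b3 + 25*b2 + 33)*?I3 +
    (2*b2^3 + 2*b2^2*b3 - 9*b2^2 - 8*b2*b3 + 18)*?J1 +
    (4*b3^3 - 4*b1*b3 - 28*b3^2 + 12*b1 + 63*b3 - 36)*?J2 +
    (2*b1^2 - 5*b1*b2 + b1*b3 - b2*b3 - 4*b1 + 11*b2 + 4*b3 - 14)*?J3"
    by algebra
  then show ?thesis unfolding assms by simp
qed

lemma cyclic_quartic:
  fixes b1 b2 b3 :: real
  assumes "(3-b2)*(b3*b1+b1*b2-3*b1-3*b2+6) + b1*b2*(3-b1)*(4*b1+3*b2+3*b3-b1*b2-b2*b3-10) = 0" (is "?I1 = 0")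
    and "(3-b3)*(b1*b2+b2*b3-3*b2-3*b3+6) + b2*b3*(3-b2)*(4*b2+3*b3+3*b1-b2*b3-b3*b1-10) = 0" (is "?I2 = 0")
    and "(3-b1)*(b2*b3+b3*b1-3*b3-3*b1+6) + b3*b1*(3-b3)*(4*b3+3*b1+3*b2-b3*b1-b1*b2-10) = 0" (is "?I3 = 0")
    and "b3*(b3*b1+b1*b2-3*b1-3*b2+6) + b1*(3-b1)*(3-b3)*(3*b3-b1-b2*b3-b3*b1+2) = 0" (is "?J1 = 0")
    and "b1*(b1*b2+b2*b3-3*b2-3*b3+6) + b2*(3-b2)*(3-b1)*(3*b1-b2-b3*b1-b1*b2+2) = 0" (is "?J2 = 0")
    and "b2*(b2*b3+b3*b1-3*b3-3*b1+6) + b3*(3-b3)*(3-b2)*(3*b2-b3-b1*b2-b2*b3+2) = 0" (is "?J3 = 0")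
    and "b2*b3*(4*b1+3*b2+3*b3-b1*b2-b2*b3-10) - (3-b2)*(3-b3)*(3*b3-b1-b2*b3-b3*b1+2) = 0" (is "?K1 = 0")
    and "b3*b1*(4*b2+3*b3+3*b1-b2*b3-b3*b1-10) - (3-b3)*(3-b1)*(3*b1-b2-b3*b1-b1*b2+2) = 0" (is "?K2 = 0")
    and "b1*b2*(4*b3+3*b1+3*b2-b3*b1-b1*b2-10) - (3-b1)*(3-b2)*(3*b2-b3-b1*b2-b2*b3+2) = 0" (is "?K3 = 0")
  shows "((b1+b2+b3)^2 - 9*(b1+b2+b3) - 27) * ((b1+b2+b3)^2 - 9*(b1+b2+b3) + 25) = 0"
proof -
  let ?E1 = "b1^2 - b3^2 - 2*b1 - 2*b2 + 4*b3" and ?E2 = "b2^2 - b1^2 - 2*b2 - 2*b3 + 4*b1"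
  let ?Q = "13*(b1*b2+b1*b3+b2*b3) - 5*(b1+b2+b3)^2 + 6*(b1+b2+b3) + 18"
  \<comment> \<open>A cyclic shift of \<open>b1\<close>, \<open>b2\<close>, \<open>b3\<close>
    permutes the assumptions and takes \<open>?E1\<close> to \<open>?E2\<close>.\<close>
  have E: "?E1 = 0" "?E2 = 0"
    by (rule cyclic_quadratic; use assms in linarith)+
  \<comment> \<open>\<open>?Q = 0\<close> expresses the second elementary symmetric polynomial by
    the sum, which prepares an equation in the sum alone.\<close>
  have "9 * ?Q =
    (39*b1*b3 + 9*b2*b3 + 39*b1 + 30*b2 - 93*b3 - 252)*?E1 +
    (39*b1*b3 + 48*b2*b3 + 33*b3^2 + 39*b1 - 123*b3 - 102)*?E2 +
    (5*b1*b3 + 4*b2*b3 + 9*b1 + b3 - 20)*?K1 +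
    (9*b2*b3 - 12*b2 - 40*b3 - 11)*?K2 +
    (- 8*b2*b3 + 6*b3 + 49)*?K3 +
    12*?I2 +
    (- 12*b2^2 + 31*b2 + 15)*?I3 +
    (- 12*b3^2 + 36*b3)*?J2 +
    (7*b1 - 12)*?J3"
    by algebra
  then have Q: "?Q = 0" unfolding assms E by simp
  have "108 * (((b1+b2+b3)^2 - 9*(b1+b2+b3) - 27) * ((b1+b2+b3)^2 - 9*(b1+b2+b3) + 25)) =
    (108*b1^2 - 1383*b1*b2 + 1659*b1*b3 - 2765*b2^2 + 1659*b2*b3 - 568*b3^2 - 4456*b1 + 8726*b2 - 400*b3 + 3870)*?E1 +
    (3042*b1*b3 - 2197*b2^2 - 2873*b3^2 - 5408*b1 + 3718*b2 + 7774*b3 + 6084)*?E2 +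
    (- 363*b1*b2 - 363*b1*b3 - 461*b2^2 - 363*b2*b3 + 92*b3^2 + 536*b1 + 2564*b2 + 1274*b3 - 4050)*?Q"
    by algebra
  then show ?thesis unfolding E Q by simp
qed

text \<open>
  For three pairs of axes as in the introduction, \<open>A1 = a - p0\<close>, \<open>A2 = p1 + p4\<close>, \<open>A3 = p2 - p3\<close> are the
  unit vectors and \<open>B1 = a + p0\<close>, \<open>B2 = p1 - p4\<close>, \<open>B3 = p2 + p3\<close>; the \<open>t\<close>'s are the differences of the
  squared norms. The orthogonal frames are \<open>(A1, B2, B1 - A2)\<close> and its cyclic images.
\<close>

locale linked_frames =
  fixes A1 A2 A3 B1 B2 B3 :: "real ^ 3" and t1 t2 t3 b1 b2 b3 :: real
  assumes AA: "A1 \<bullet> A1 = 1" "A2 \<bullet> A2 = 1" "A3 \<bullet> A3 = 1"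
      "A1 \<bullet> A2 = t1" "A2 \<bullet> A3 = t2" "A3 \<bullet> A1 = t3"
    and AB: "A1 \<bullet> B1 = t1" "A2 \<bullet> B2 = t2" "A3 \<bullet> B3 = t3"
      "A1 \<bullet> B2 = 0" "A2 \<bullet> B3 = 0" "A3 \<bullet> B1 = 0"
      "A1 \<bullet> B3 = (b1 + b3 - 2) / 2" "A2 \<bullet> B1 = (b2 + b1 - 2) / 2" "A3 \<bullet> B2 = (b3 + b2 - 2) / 2"
    and BB: "B1 \<bullet> B1 = b1" "B2 \<bullet> B2 = b2" "B3 \<bullet> B3 = b3"
      "B1 \<bullet> B2 = t2" "B2 \<bullet> B3 = t3" "B3 \<bullet> B1 = t1"
begin

lemma rotation1: "linked_frames A2 A3 A1 B2 B3 B1 t2 t3 t1 b2 b3 b1"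
  by unfold_locales (use AA AB BB in \<open>simp_all add: inner_commute\<close>)

lemma rotation2: "linked_frames A3 A1 A2 B3 B1 B2 t3 t1 t2 b3 b1 b2"
  by (rule linked_frames.rotation1[OF rotation1])

lemma orthogonal_frame: "A1 \<bullet> B2 = 0" "A1 \<bullet> (B1 - A2) = 0" "B2 \<bullet> (B1 - A2) = 0"
  using AA AB BB by (simp_all add: inner_diff_right inner_commute)

lemma norm_third_axis: "(B1 - A2) \<bullet> (B1 - A2) = 3 - b2"
  using AA AB BB by (simp add: inner_diff_right inner_diff_left inner_commute field_simps)

lemmas frame_inner =
  orthogonal_frame_inner[OF orthogonal_frame, unfolded AA BB norm_third_axis]

text \<open>The inner products with the axes \<open>A1\<close>, \<open>B2\<close>,
  \<open>B1 - A2\<close> are \<open>t1\<close>, \<open>t2\<close>, \<open>(b1 + b2 - 4) / 2\<close>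
  for \<open>A2\<close>, then \<open>t3\<close>, \<open>(b2 + b3 - 2) / 2\<close>,
  \<open>- t2\<close> for \<open>A3\<close>, and \<open>(b1 + b3 - 2) / 2\<close>,
  \<open>t3\<close>, \<open>t1\<close> for \<open>B3\<close>. This and the next three lemmas
  substitute them into \<open>frame_inner\<close>.\<close>

lemma expand_A2_A2:
  "4 * (b2 * (3 - b2)) = 4 * t1^2 * b2 * (3 - b2) + 4 * t2^2 * (3 - b2) + (b1 + b2 - 4)^2 * b2"
  using frame_inner[of A2 A2] AA AB BB
  by (simp add: inner_diff_right inner_commute field_simps power2_eq_square)

lemma expand_A2_A3:
  "t2 * (b1*b2 + b2*b3 - 3*b2 - 3*b3 + 6) = 2 * t1 * t3 * b2 * (3 - b2)"
proof -
  have "t2 * b2 * (3 - b2) = t1 * t3 * b2 * (3 - b2) + t2 * ((b3 + b2 - 2) / 2) * (3 - b2)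
      + ((b2 + b1 - 2) / 2 - 1) * (0 - t2) * b2"
    using frame_inner[of A2 A3] AA AB BB by (simp add: inner_diff_right inner_commute)
  then show ?thesis by algebra
qed

lemma expand_A2_B3:
  "t1 * b2 * (4*b1 + 3*b2 + 3*b3 - b1*b2 - b2*b3 - 10) = - 2 * t2 * t3 * (3 - b2)"
proof -
  have "0 = t1 * ((b1 + b3 - 2) / 2) * b2 * (3 - b2) + t2 * t3 * (3 - b2)
      + ((b2 + b1 - 2) / 2 - 1) * t1 * b2"
    using frame_inner[of A2 B3] AA AB BB by (simp add: inner_diff_right inner_commute)
  then show ?thesis by algebra
qed

lemma expand_A3_B3:
  "t3 * (3 - b2) * (3*b2 - b3 - b1*b2 - b2*b3 + 2) = - 2 * t1 * t2 * b2"
proof -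
  have "t3 * b2 * (3 - b2) = t3 * ((b1 + b3 - 2) / 2) * b2 * (3 - b2) + ((b3 + b2 - 2) / 2) * t3 * (3 - b2)
      + (0 - t2) * t1 * b2"
    using frame_inner[of A3 B3] AA AB BB by (simp add: inner_diff_right inner_commute)
  then show ?thesis by algebra
qed

text \<open>The third axis vanishes, so \<open>B1 = A2\<close>. Then
  \<open>t1 = B3 \<bullet> B1 = B3 \<bullet> A2 = 0\<close> and
  \<open>t2 = A2 \<bullet> A3 = B1 \<bullet> A3 = 0\<close>.\<close>

lemma third_axis_degenerate: "b2 = 3 \<Longrightarrow> t1 = 0 \<and> t2 = 0"
proof -
  assume "b2 = 3"
  with norm_third_axis have "B1 = A2" by simp
  with AA AB BB show ?thesis by (simp add: inner_commute)
qed

text \<open>Three expansions, one from each frame, equate a multiple of \<open>t1\<close> with a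
  multiple of \<open>t2 * t3\<close>. Eliminating that product from any two leaves \<open>t1\<close>
  times a polynomial in \<open>b1\<close>, \<open>b2\<close>, \<open>b3\<close>.\<close>

lemma elimination:
  assumes "t1 \<noteq> 0"
  shows "(3-b2)*(b3*b1+b1*b2-3*b1-3*b2+6) + b1*b2*(3-b1)*(4*b1+3*b2+3*b3-b1*b2-b2*b3-10) = 0"
    and "b3*(b3*b1+b1*b2-3*b1-3*b2+6) + b1*(3-b1)*(3-b3)*(3*b3-b1-b2*b3-b3*b1+2) = 0"
    and "b2*b3*(4*b1+3*b2+3*b3-b1*b2-b2*b3-10) - (3-b2)*(3-b3)*(3*b3-b1-b2*b3-b3*b1+2) = 0"
proof -
  define N M K where "N = b3*b1+b1*b2-3*b1-3*b2+6" and "M = 4*b1+3*b2+3*b3-b1*b2-b2*b3-10"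
    and "K = 3*b3-b1-b2*b3-b3*b1+2"
  have N: "t1 * N = 2 * t2 * t3 * b1 * (3 - b1)"
    using linked_frames.expand_A2_A3[OF rotation2] by (simp add: N_def algebra_simps)
  have M: "t1 * b2 * M = - 2 * t2 * t3 * (3 - b2)"
    using expand_A2_B3 by (simp add: M_def)
  have K: "t1 * (3 - b3) * K = - 2 * t2 * t3 * b3"
    using linked_frames.expand_A3_B3[OF rotation1] by (simp add: K_def algebra_simps)
  have "t1 * ((3-b2)*N + b1*b2*(3-b1)*M) = 0" using N M by algebra
  moreover have "t1 * (b3*N + b1*(3-b1)*(3-b3)*K) = 0" using N K by algebra
  moreover have "t1 * (b2*b3*M - (3-b2)*(3-b3)*K) = 0" using M K by algebra
  ultimately show "(3-b2)*(b3*b1+b1*b2-3*b1-3*b2+6) + b1*b2*(3-b1)*(4*b1+3*b2+3*b3-b1*b2-b2*b3-10) = 0"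
    and "b3*(b3*b1+b1*b2-3*b1-3*b2+6) + b1*(3-b1)*(3-b3)*(3*b3-b1-b2*b3-b3*b1+2) = 0"
    and "b2*b3*(4*b1+3*b2+3*b3-b1*b2-b2*b3-10) - (3-b2)*(3-b3)*(3*b3-b1-b2*b3-b3*b1+2) = 0"
    using assms by (simp_all add: N_def M_def K_def)
qed

text \<open>\<open>b2\<close> and \<open>3 - b2\<close> are the squared norms of \<open>B2\<close>
  and \<open>B1 - A2\<close>; if either vector vanished, \<open>t2\<close> would be zero.\<close>

lemma bounds: "t2 \<noteq> 0 \<Longrightarrow> 0 < b2 \<and> b2 < 3"
proof -
  assume t2: "t2 \<noteq> 0"
  have "b2 \<ge> 0" "b2 \<le> 3"
    using inner_ge_zero[of B2] inner_ge_zero[of "B1 - A2"] unfolding BB norm_third_axis by auto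
  moreover have "b2 \<noteq> 3" using third_axis_degenerate t2 by blast
  moreover have "b2 \<noteq> 0" using BB(2) AB(2) t2 by auto
  ultimately show ?thesis by simp
qed

text \<open>Otherwise the sum \<open>s\<close> of the \<open>b\<close>'s lies strictly between 0 and
  9. There the first factor in \<open>cyclic_quartic\<close> is negative, and the second is
  \<open>(s - 9/2)^2 + 19/4\<close>, so positive.\<close>

lemma not_all_nonzero: "t1 = 0 \<or> t2 = 0 \<or> t3 = 0"
proof (rule ccontr)
  assume "\<not> ?thesis"
  then have nz: "t1 \<noteq> 0" "t2 \<noteq> 0" "t3 \<noteq> 0" by auto
  let ?s = "b1 + b2 + b3"
  note e1 = elimination[OF nz(1)] and e2 = linked_frames.elimination[OF rotation1 nz(2)]
    and e3 = linked_frames.elimination[OF rotation2 nz(3)]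
  have "(?s^2 - 9 * ?s - 27) * (?s^2 - 9 * ?s + 25) = 0"
    by (rule cyclic_quartic[OF e1(1) e2(1) e3(1) e1(2) e2(2) e3(2) e1(3) e2(3) e3(3)])
  moreover have "0 < ?s" "?s < 9"
    using bounds[OF nz(2)] linked_frames.bounds[OF rotation1 nz(3)]
      linked_frames.bounds[OF rotation2 nz(1)] by auto
  then have "?s * (?s - 9) < 0" by (simp add: mult_less_0_iff)
  then have "?s^2 - 9 * ?s - 27 < 0" by (simp add: power2_eq_square algebra_simps)
  moreover have "(?s - 9 / 2)^2 \<ge> 0" by simp
  then have "?s^2 - 9 * ?s + 25 > 0" by (simp add: power2_eq_square algebra_simps)
  ultimately show False by simp
qed

text \<open>\<open>expand_A2_B3\<close> leaves \<open>t2 * t3 * (3 - b2) = 0\<close>, and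
  \<open>b2 = 3\<close> itself forces \<open>t2 = 0\<close>.\<close>

lemma zero_imp_product_zero: "t1 = 0 \<Longrightarrow> t2 * t3 = 0"
  using expand_A2_B3 third_axis_degenerate by fastforce

lemma at_most_one_nonzero: "t1 = 0 \<and> t2 = 0 \<or> t2 = 0 \<and> t3 = 0 \<or> t1 = 0 \<and> t3 = 0"
  using not_all_nonzero zero_imp_product_zero linked_frames.zero_imp_product_zero[OF rotation1]
    linked_frames.zero_imp_product_zero[OF rotation2] by auto

lemma equal_frames:
  assumes "t2 = 0" "t3 = 0" "b2 = b3" "b2 \<noteq> 0"
  shows "b2^2 = 3 * b2 - 1" and "t1 = 0 \<or> b1 * (4 - b2) = 9 - 3 * b2"
proof -
  \<comment> \<open>In the expansion of \<open>A3 \<bullet> A3\<close> in the frame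
    \<open>(A2, B3, B2 - A3)\<close> only the last term survives.\<close>
  have "b2 * (b2^2 - 3 * b2 + 1) = 0"
    using linked_frames.expand_A2_A2[OF rotation1] assms
    by (simp add: algebra_simps power2_eq_square)
  with assms show b2: "b2^2 = 3 * b2 - 1" by simp
  have "b2 * (t1 * (b1 * (4 - b2) - (9 - 3 * b2) - (b2^2 - 3 * b2 + 1))) = 0"
    using expand_A2_B3 assms by (simp add: algebra_simps power2_eq_square)
  with assms(4) have "t1 * (b1 * (4 - b2) - (9 - 3 * b2) - (b2^2 - 3 * b2 + 1)) = 0" by simp
  with b2 show "t1 = 0 \<or> b1 * (4 - b2) = 9 - 3 * b2" by simp
qed

end

subsection \<open>Six axes\<close>

text \<open>The five splittings partition the fifteen pairs, and each allows at most one unequal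
  pair. Six values that are neither all equal nor divided as 5 + 1 have at least eight unequal
  pairs.\<close>

lemma five_of_six_equal:
  fixes a p0 p1 p2 p3 p4 :: real
  assumes "a - p0 = 0 \<and> p1 - p4 = 0 \<or> p1 - p4 = 0 \<and> p2 - p3 = 0 \<or> a - p0 = 0 \<and> p2 - p3 = 0"
    and "a - p1 = 0 \<and> p2 - p0 = 0 \<or> p2 - p0 = 0 \<and> p3 - p4 = 0 \<or> a - p1 = 0 \<and> p3 - p4 = 0"
    and "a - p2 = 0 \<and> p3 - p1 = 0 \<or> p3 - p1 = 0 \<and> p4 - p0 = 0 \<or> a - p2 = 0 \<and> p4 - p0 = 0"
    and "a - p3 = 0 \<and> p4 - p2 = 0 \<or> p4 - p2 = 0 \<and> p0 - p1 = 0 \<or> a - p3 = 0 \<and> p0 - p1 = 0"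
    and "a - p4 = 0 \<and> p0 - p3 = 0 \<or> p0 - p3 = 0 \<and> p1 - p2 = 0 \<or> a - p4 = 0 \<and> p1 - p2 = 0"
  shows "p1 = p0 \<and> p2 = p0 \<and> p3 = p0 \<and> p4 = p0 \<or> p1 = a \<and> p2 = a \<and> p3 = a \<and> p4 = a \<or>
    p2 = a \<and> p3 = a \<and> p4 = a \<and> p0 = a \<or> p3 = a \<and> p4 = a \<and> p0 = a \<and> p1 = a \<or>
    p4 = a \<and> p0 = a \<and> p1 = a \<and> p2 = a \<or> p0 = a \<and> p1 = a \<and> p2 = a \<and> p3 = a"
  using assms by argo

text \<open>In terms of \<open>\<phi> = 4 * n - 2\<close> the quadratic equation is \<open>\<phi>\<^sup>2 = \<phi> + 1\<close>.\<close>

definition admissible_norms :: "real \<Rightarrow> real \<Rightarrow> bool" where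
  "admissible_norms n r \<longleftrightarrow> 16 * n^2 - 20 * n + 5 = 0 \<and> (r = n \<or> r = 2 - 11 / 5 * n)"

lemma inner_eq_of_norm_diff: "norm (u - v) = 1 \<Longrightarrow> u \<bullet> v = (u \<bullet> u + v \<bullet> v - 1) / 2"
  for u v :: "'a :: real_inner"
  by (simp add: norm_eq_1 inner_diff_left inner_diff_right inner_commute)

lemma inner_eq_of_norm_add: "norm (u + v) = 1 \<Longrightarrow> u \<bullet> v = - (u \<bullet> u + v \<bullet> v - 1) / 2"
  for u v :: "'a :: real_inner"
  by (simp add: norm_eq_1 inner_add_left inner_add_right inner_commute)

text \<open>The plus signs in \<open>diagonal\<close> arise because each neighbour of
  \<open>a\<close> is adjacent to the opposite of the next but one. \<open>distinct\<close> keeps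
  \<open>p1 - p4\<close> and its rotations from vanishing.\<close>

locale six_axes =
  fixes a p0 p1 p2 p3 p4 :: "real ^ 3"
  assumes hub: "norm (a - p0) = 1" "norm (a - p1) = 1" "norm (a - p2) = 1" "norm (a - p3) = 1"
      "norm (a - p4) = 1"
    and side: "norm (p0 - p1) = 1" "norm (p1 - p2) = 1" "norm (p2 - p3) = 1" "norm (p3 - p4) = 1"
      "norm (p4 - p0) = 1"
    and diagonal: "norm (p0 + p2) = 1" "norm (p1 + p3) = 1" "norm (p2 + p4) = 1" "norm (p3 + p0) = 1"
      "norm (p4 + p1) = 1"
    and distinct: "p0 \<noteq> p2" "p1 \<noteq> p3" "p2 \<noteq> p4" "p3 \<noteq> p0" "p4 \<noteq> p1"
begin

lemma rotate: "six_axes a p1 p2 p3 p4 p0"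
  by unfold_locales (use hub side diagonal distinct in auto)

lemmas inners =
  hub[THEN inner_eq_of_norm_diff] side[THEN inner_eq_of_norm_diff] diagonal[THEN inner_eq_of_norm_add]

text \<open>In each pair the sum or the difference has norm 1; the parallelogram law gives the
  squared norm of the other.\<close>

lemma linked:
  "linked_frames (a - p0) (p1 + p4) (p2 - p3) (a + p0) (p1 - p4) (p2 + p3)
    (a \<bullet> a - p0 \<bullet> p0) (p1 \<bullet> p1 - p4 \<bullet> p4) (p2 \<bullet> p2 - p3 \<bullet> p3)
    (2 * (a \<bullet> a + p0 \<bullet> p0) - 1) (2 * (p1 \<bullet> p1 + p4 \<bullet> p4) - 1) (2 * (p2 \<bullet> p2 + p3 \<bullet> p3) - 1)"
  by unfold_locales
    (use inners in \<open>simp_all add: inner_diff_left inner_diff_right inner_add_left inner_add_right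
      inner_commute field_simps\<close>)

lemma equal_spokes:
  assumes n: "p1 \<bullet> p1 = n" "p2 \<bullet> p2 = n" "p3 \<bullet> p3 = n" "p4 \<bullet> p4 = n"
  shows "a \<bullet> a = n \<Longrightarrow> admissible_norms n (p0 \<bullet> p0)"
    and "p0 \<bullet> p0 = n \<Longrightarrow> admissible_norms n (a \<bullet> a)"
proof -
  interpret linked_frames "a - p0" "p1 + p4" "p2 - p3" "a + p0" "p1 - p4" "p2 + p3"
    "a \<bullet> a - p0 \<bullet> p0" "p1 \<bullet> p1 - p4 \<bullet> p4" "p2 \<bullet> p2 - p3 \<bullet> p3"
    "2 * (a \<bullet> a + p0 \<bullet> p0) - 1" "2 * (p1 \<bullet> p1 + p4 \<bullet> p4) - 1" "2 * (p2 \<bullet> p2 + p3 \<bullet> p3) - 1"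
    by (rule linked)
  have "2 * (p1 \<bullet> p1 + p4 \<bullet> p4) - 1 \<noteq> 0" using BB(2) distinct(5) by auto
  then have "(4 * n - 1)^2 = 3 * (4 * n - 1) - 1"
    and alt: "a \<bullet> a = p0 \<bullet> p0 \<or> (2 * (a \<bullet> a + p0 \<bullet> p0) - 1) * (4 - (4 * n - 1)) = 9 - 3 * (4 * n - 1)"
    using equal_frames n by auto
  then have quadratic: "16 * n^2 - 20 * n + 5 = 0" by (simp add: power2_eq_square algebra_simps)
  have *: "x = 2 - 11 / 5 * n" if "(2 * (n + x) - 1) * (4 - (4 * n - 1)) = 9 - 3 * (4 * n - 1)" for x
  proof -
    \<comment> \<open>The hypothesis is multiplied by \<open>4 * n\<close>, because the quadratic
      makes \<open>(5 - 4 * n) * (4 * n)\<close> equal to 5.\<close>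
    have "(5 * x - 10 + 11 * n) * ((5 - 4 * n) * (4 * n)) = 0"
      using that quadratic by algebra
    moreover have "(5 - 4 * n) * (4 * n) = 5" using quadratic by algebra
    ultimately show ?thesis by simp
  qed
  show "admissible_norms n (p0 \<bullet> p0)" if "a \<bullet> a = n"
    using alt *[of "p0 \<bullet> p0"] quadratic unfolding that admissible_norms_def by metis
  show "admissible_norms n (a \<bullet> a)" if "p0 \<bullet> p0 = n"
    using alt *[of "a \<bullet> a"] quadratic unfolding that admissible_norms_def by (metis add.commute)
qed

text \<open>If the exceptional axis is a neighbour of \<open>a\<close>, a rotation moves it to the
  place of \<open>p0\<close>, the partner of \<open>a\<close>, where \<open>equal_spokes\<close>
  applies.\<close>

lemma norms:
  "\<exists>n r. admissible_norms n r \<and>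
    map (\<lambda>v. v \<bullet> v) [a, p0, p1, p2, p3, p4] \<in>
      {[r, n, n, n, n, n], [n, r, n, n, n, n], [n, n, r, n, n, n], [n, n, n, r, n, n],
       [n, n, n, n, r, n], [n, n, n, n, n, r]}"
proof -
  note r1 = rotate
  note r2 = six_axes.rotate[OF r1]
  note r3 = six_axes.rotate[OF r2]
  note r4 = six_axes.rotate[OF r3]
  note s = linked_frames.at_most_one_nonzero[OF six_axes.linked]
  from five_of_six_equal[OF s[OF six_axes_axioms] s[OF r1] s[OF r2] s[OF r3] s[OF r4]]
  consider "p1 \<bullet> p1 = p0 \<bullet> p0" "p2 \<bullet> p2 = p0 \<bullet> p0" "p3 \<bullet> p3 = p0 \<bullet> p0" "p4 \<bullet> p4 = p0 \<bullet> p0"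
    | "p1 \<bullet> p1 = a \<bullet> a" "p2 \<bullet> p2 = a \<bullet> a" "p3 \<bullet> p3 = a \<bullet> a" "p4 \<bullet> p4 = a \<bullet> a"
    | "p2 \<bullet> p2 = a \<bullet> a" "p3 \<bullet> p3 = a \<bullet> a" "p4 \<bullet> p4 = a \<bullet> a" "p0 \<bullet> p0 = a \<bullet> a"
    | "p3 \<bullet> p3 = a \<bullet> a" "p4 \<bullet> p4 = a \<bullet> a" "p0 \<bullet> p0 = a \<bullet> a" "p1 \<bullet> p1 = a \<bullet> a"
    | "p4 \<bullet> p4 = a \<bullet> a" "p0 \<bullet> p0 = a \<bullet> a" "p1 \<bullet> p1 = a \<bullet> a" "p2 \<bullet> p2 = a \<bullet> a"
    | "p0 \<bullet> p0 = a \<bullet> a" "p1 \<bullet> p1 = a \<bullet> a" "p2 \<bullet> p2 = a \<bullet> a" "p3 \<bullet> p3 = a \<bullet> a"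
    by blast
  then show ?thesis
  proof cases
    case 1
    show ?thesis
      by (intro exI[of _ "p0 \<bullet> p0"] exI[of _ "a \<bullet> a"]) (simp add: 1 equal_spokes(2)[OF 1 refl])
  next
    case 2
    show ?thesis
      by (intro exI[of _ "a \<bullet> a"] exI[of _ "p0 \<bullet> p0"]) (simp add: 2 equal_spokes(1)[OF 2 refl])
  next
    case 3
    show ?thesis
      by (intro exI[of _ "a \<bullet> a"] exI[of _ "p1 \<bullet> p1"])
        (simp add: 3 six_axes.equal_spokes(1)[OF r1 3 refl])
  next
    case 4
    show ?thesis
      by (intro exI[of _ "a \<bullet> a"] exI[of _ "p2 \<bullet> p2"])
        (simp add: 4 six_axes.equal_spokes(1)[OF r2 4 refl])
  next
    case 5
    show ?thesis
      by (intro exI[of _ "a \<bullet> a"] exI[of _ "p3 \<bullet> p3"])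
        (simp add: 5 six_axes.equal_spokes(1)[OF r3 5 refl])
  next
    case 6
    show ?thesis
      by (intro exI[of _ "a \<bullet> a"] exI[of _ "p4 \<bullet> p4"])
        (simp add: 6 six_axes.equal_spokes(1)[OF r4 6 refl])
  qed
qed

end

subsection \<open>Centrally symmetric icosahedra\<close>

definition central_icosahedra :: "(vertex \<Rightarrow> real ^ 3) set" where
  "central_icosahedra = {V \<in> icosahedra. \<forall>i. V i + V (perm_d i) = 0}"

text \<open>For \<open>r = n\<close> every \<open>k\<close> is allowed, so the patterns without an
  exceptional axis fit the same form.\<close>

definition norm_profile :: "(vertex \<Rightarrow> real ^ 3) \<Rightarrow> real \<Rightarrow> real \<Rightarrow> vertex \<Rightarrow> bool" where
  "norm_profile V n r k \<longleftrightarrow> (\<forall>i. V i \<bullet> V i = (if i = k \<or> i = perm_d k then r else n))"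

section \<open>Gram matrices and the isometry relation\<close>

lemma gram_matrix_nth: "gram_matrix V $ i $ j = V i \<bullet> V j"
  by (simp add: gram_matrix_def coord_matrix_def matrix_matrix_mult_def
      Finite_Cartesian_Product.transpose_def inner_vec_def)

lemma gram_action_nth: "gram_action g G $ i $ j = G $ g i $ g j"
proof -
  have "gram_action g G $ i $ j =
      (\<Sum>k\<in>UNIV. (\<Sum>l\<in>UNIV. (if l = g i then G $ l $ k else 0)) * (if k = g j then 1 else 0))"
    unfolding gram_action_def matrix_matrix_mult_def Finite_Cartesian_Product.transpose_def perm_matrix_def
    by (simp add: if_distrib[of "\<lambda>x. x * _"] cong: if_cong)
  also have "\<dots> = (\<Sum>k\<in>UNIV. if k = g j then G $ g i $ k else 0)"
    by (rule sum.cong) auto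
  finally show ?thesis by simp
qed

lemma isometry_rel_iff:
  "(V, W) \<in> isometry_rel \<longleftrightarrow> V \<in> icosahedra \<and> W \<in> icosahedra \<and>
    (\<exists>g\<in>ico_group. \<forall>i j. W i \<bullet> W j = V (g i) \<bullet> V (g j))"
  by (simp add: isometry_rel_def vec_eq_iff gram_matrix_nth gram_action_nth)

lemma central_opposite: "V \<in> central_icosahedra \<Longrightarrow> V (perm_d i) = - V i"
  by (simp add: central_icosahedra_def add_eq_0_iff)

lemma central_edge: "V \<in> central_icosahedra \<Longrightarrow> {i, j} \<in> ico_edges \<Longrightarrow> norm (V i - V j) = 1"
  by (simp add: central_icosahedra_def icosahedra_def)

lemma central_opposite_edge:
  assumes "V \<in> central_icosahedra" "{i, perm_d j} \<in> ico_edges"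
  shows "norm (V i + V j) = 1"
  using central_edge[OF assms] central_opposite[OF assms(1)] by simp

lemma central_norm_profile:
  assumes V: "V \<in> central_icosahedra"
  obtains n r k where "admissible_norms n r" "norm_profile V n r k"
proof -
  have inj: "inj V" using V by (simp add: central_icosahedra_def icosahedra_def)
  \<comment> \<open>The neighbours of vertex 1 in cyclic order are 2, 3, 6, 5, 4.\<close>
  interpret six_axes "V 1" "V 2" "V 3" "V 6" "V 5" "V 4"
  proof
    show "norm (V 1 - V 2) = 1" "norm (V 1 - V 3) = 1" "norm (V 1 - V 6) = 1"
      "norm (V 1 - V 5) = 1" "norm (V 1 - V 4) = 1"
      "norm (V 2 - V 3) = 1" "norm (V 3 - V 6) = 1" "norm (V 6 - V 5) = 1"
      "norm (V 5 - V 4) = 1" "norm (V 4 - V 2) = 1"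
      by (rule central_edge[OF V], simp add: ico_edges_eq doubleton_eq_iff)+
    show "norm (V 2 + V 6) = 1" "norm (V 3 + V 5) = 1" "norm (V 6 + V 4) = 1"
      "norm (V 5 + V 2) = 1" "norm (V 4 + V 3) = 1"
      by (rule central_opposite_edge[OF V], simp add: ico_edges_eq doubleton_eq_iff)+
    show "V 2 \<noteq> V 6" "V 3 \<noteq> V 5" "V 6 \<noteq> V 4" "V 5 \<noteq> V 2" "V 4 \<noteq> V 3"
      by (simp_all add: inj_eq[OF inj])
  qed
  obtain n r where nr: "admissible_norms n r"
    and norms: "map (\<lambda>v. v \<bullet> v) [V 1, V 2, V 3, V 6, V 5, V 4] \<in>
      {[r, n, n, n, n, n], [n, r, n, n, n, n], [n, n, r, n, n, n], [n, n, n, r, n, n],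
       [n, n, n, n, r, n], [n, n, n, n, n, r]}"
    using norms by (elim exE conjE)
  have opposite: "V 12 \<bullet> V 12 = V 1 \<bullet> V 1" "V 10 \<bullet> V 10 = V 2 \<bullet> V 2" "V 9 \<bullet> V 9 = V 3 \<bullet> V 3"
    "V 11 \<bullet> V 11 = V 4 \<bullet> V 4" "V 7 \<bullet> V 7 = V 5 \<bullet> V 5" "V 8 \<bullet> V 8 = V 6 \<bullet> V 6"
    using central_opposite[OF V, of 1] central_opposite[OF V, of 2] central_opposite[OF V, of 3]
      central_opposite[OF V, of 4] central_opposite[OF V, of 5] central_opposite[OF V, of 6]
    by simp_all
  have "\<exists>k. norm_profile V n r k"
    using norms unfolding insert_iff empty_iff
  proof (elim disjE)
    assume "map (\<lambda>v. v \<bullet> v) [V 1, V 2, V 3, V 6, V 5, V 4] = [r, n, n, n, n, n]"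
    then have "norm_profile V n r 1" unfolding norm_profile_def all_vertex by (simp add: opposite)
    then show ?thesis ..
  next
    assume "map (\<lambda>v. v \<bullet> v) [V 1, V 2, V 3, V 6, V 5, V 4] = [n, r, n, n, n, n]"
    then have "norm_profile V n r 2" unfolding norm_profile_def all_vertex by (simp add: opposite)
    then show ?thesis ..
  next
    assume "map (\<lambda>v. v \<bullet> v) [V 1, V 2, V 3, V 6, V 5, V 4] = [n, n, r, n, n, n]"
    then have "norm_profile V n r 3" unfolding norm_profile_def all_vertex by (simp add: opposite)
    then show ?thesis ..
  next
    assume "map (\<lambda>v. v \<bullet> v) [V 1, V 2, V 3, V 6, V 5, V 4] = [n, n, n, r, n, n]"
    then have "norm_profile V n r 6" unfolding norm_profile_def all_vertex by (simp add: opposite)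
    then show ?thesis ..
  next
    assume "map (\<lambda>v. v \<bullet> v) [V 1, V 2, V 3, V 6, V 5, V 4] = [n, n, n, n, r, n]"
    then have "norm_profile V n r 5" unfolding norm_profile_def all_vertex by (simp add: opposite)
    then show ?thesis ..
  next
    assume "map (\<lambda>v. v \<bullet> v) [V 1, V 2, V 3, V 6, V 5, V 4] = [n, n, n, n, n, r]"
    then have "norm_profile V n r 4" unfolding norm_profile_def all_vertex by (simp add: opposite)
    then show ?thesis ..
  qed simp
  with nr that show ?thesis by blast
qed

text \<open>Opposite vertices differ by a sign, and for all other pairs a unit sum or difference
  fixes the inner product by polarization; \<open>g\<close> respects edges and opposites.\<close>

lemma central_gram_determined:
  assumes V: "V \<in> central_icosahedra" and W: "W \<in> central_icosahedra" and g: "g \<in> ico_group"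
    and norms: "\<And>i. W i \<bullet> W i = V (g i) \<bullet> V (g i)"
  shows "W i \<bullet> W j = V (g i) \<bullet> V (g j)"
proof -
  consider "j = i" | "j = perm_d i" | "{i, j} \<in> ico_edges" | "{i, perm_d j} \<in> ico_edges"
    using vertex_pair_cases[of j i] by blast
  then show ?thesis
  proof cases
    case 1
    then show ?thesis by (simp add: norms)
  next
    case 2
    then show ?thesis
      by (simp add: norms central_opposite[OF V] central_opposite[OF W] ico_group_commute_perm_d[OF g])
  next
    case 3
    then have "{g i, g j} \<in> ico_edges" by (simp add: ico_edges_ico_group[OF g])
    with 3 show ?thesis
      using central_edge[OF V] central_edge[OF W] norms by (simp add: inner_eq_of_norm_diff)
  next
    case 4
    then have "{g i, perm_d (g j)} \<in> ico_edges"
      by (simp add: ico_edges_ico_group[OF g] ico_group_commute_perm_d[OF g, symmetric])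
    with 4 show ?thesis
      using central_opposite_edge[OF V] central_opposite_edge[OF W] norms
      by (simp add: inner_eq_of_norm_add)
  qed
qed

text \<open>Transitivity provides a group element taking the exceptional axis of \<open>W\<close> to
  that of \<open>V\<close>; then all norms agree.\<close>

lemma central_isometric:
  assumes V: "V \<in> central_icosahedra" and W: "W \<in> central_icosahedra"
    and "norm_profile V n r k" "norm_profile W n r l"
  shows "(V, W) \<in> isometry_rel"
proof -
  obtain g where g: "g \<in> ico_group" "g l = k" using ico_group_transitive by blast
  have inj: "g i = g j \<longleftrightarrow> i = j" for i j using ico_group_bij[OF g(1)] by (simp add: bij_is_inj inj_eq)
  have "g i = k \<or> g i = perm_d k \<longleftrightarrow> i = l \<or> i = perm_d l" for i
    using inj[of i l] inj[of i "perm_d l"] g(2) ico_group_commute_perm_d[OF g(1), of l] by simp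
  then have "W i \<bullet> W i = V (g i) \<bullet> V (g i)" for i
    using assms(3,4) by (simp add: norm_profile_def)
  then have "\<forall>i j. W i \<bullet> W j = V (g i) \<bullet> V (g j)"
    using central_gram_determined[OF V W g(1)] by blast
  with V W g(1) show ?thesis by (auto simp: isometry_rel_iff central_icosahedra_def)
qed

lemma isometric_central:
  assumes V: "V \<in> central_icosahedra" "norm_profile V n r k" and "(V, W) \<in> isometry_rel"
  shows "W \<in> central_icosahedra" "\<exists>l. norm_profile W n r l"
proof -
  obtain g where g: "g \<in> ico_group" and W: "W \<in> icosahedra"
    and gram: "\<And>i j. W i \<bullet> W j = V (g i) \<bullet> V (g j)"
    using assms(3) unfolding isometry_rel_iff by blast
  \<comment> \<open>Central symmetry is visible in the Gram matrix: this squared norm is a sum of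
    its entries.\<close>
  have "(W i + W (perm_d i)) \<bullet> (W i + W (perm_d i)) = 0" for i
    by (simp add: inner_add_left inner_add_right gram ico_group_commute_perm_d[OF g] central_opposite[OF V(1)])
  then show "W \<in> central_icosahedra" using W by (simp add: central_icosahedra_def)
  obtain l where l: "g l = k" using ico_group_bij[OF g] by (metis bij_pointE)
  have inj: "g i = g j \<longleftrightarrow> i = j" for i j using ico_group_bij[OF g] by (simp add: bij_is_inj inj_eq)
  have "g i = k \<or> g i = perm_d k \<longleftrightarrow> i = l \<or> i = perm_d l" for i
    using inj[of i l] inj[of i "perm_d l"] l ico_group_commute_perm_d[OF g, of l] by simp
  then have "norm_profile W n r l" using V(2) by (simp add: norm_profile_def gram)
  then show "\<exists>l. norm_profile W n r l" ..
qed

subsection \<open>The four classes\<close>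

text \<open>
  For the two roots of \<open>\<phi>\<^sup>2 = \<phi> + 1\<close> and \<open>s = 1\<close> these are the regular and the great icosahedron; the
  factor \<open>s = (4 * \<phi> - 7) / 5\<close> reflects the vertices 1 and 12 in the planes spanned by their neighbours.
\<close>

definition scaled_icosahedron :: "real \<Rightarrow> real \<Rightarrow> vertex \<Rightarrow> real ^ 3" where
  "scaled_icosahedron \<phi> s i = (1 / 2) *\<^sub>R
    (if i = 1 then vector [0, s, s * \<phi>] else
     if i = 2 then vector [\<phi>, 0, 1] else
     if i = 3 then vector [1, \<phi>, 0] else
     if i = 4 then vector [0, - 1, \<phi>] else
     if i = 5 then vector [- \<phi>, 0, 1] else
     if i = 6 then vector [- 1, \<phi>, 0] else
     if i = 7 then vector [\<phi>, 0, - 1] else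
     if i = 8 then vector [1, - \<phi>, 0] else
     if i = 9 then vector [- 1, - \<phi>, 0] else
     if i = 10 then vector [- \<phi>, 0, - 1] else
     if i = 11 then vector [0, 1, - \<phi>] else
     vector [0, - s, - s * \<phi>])"

lemma scaled_icosahedron_nth:
  "scaled_icosahedron \<phi> s 1 = (1 / 2) *\<^sub>R vector [0, s, s * \<phi>]"
  "scaled_icosahedron \<phi> s 2 = (1 / 2) *\<^sub>R vector [\<phi>, 0, 1]"
  "scaled_icosahedron \<phi> s 3 = (1 / 2) *\<^sub>R vector [1, \<phi>, 0]"
  "scaled_icosahedron \<phi> s 4 = (1 / 2) *\<^sub>R vector [0, - 1, \<phi>]"
  "scaled_icosahedron \<phi> s 5 = (1 / 2) *\<^sub>R vector [- \<phi>, 0, 1]"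
  "scaled_icosahedron \<phi> s 6 = (1 / 2) *\<^sub>R vector [- 1, \<phi>, 0]"
  "scaled_icosahedron \<phi> s 7 = (1 / 2) *\<^sub>R vector [\<phi>, 0, - 1]"
  "scaled_icosahedron \<phi> s 8 = (1 / 2) *\<^sub>R vector [1, - \<phi>, 0]"
  "scaled_icosahedron \<phi> s 9 = (1 / 2) *\<^sub>R vector [- 1, - \<phi>, 0]"
  "scaled_icosahedron \<phi> s 10 = (1 / 2) *\<^sub>R vector [- \<phi>, 0, - 1]"
  "scaled_icosahedron \<phi> s 11 = (1 / 2) *\<^sub>R vector [0, 1, - \<phi>]"
  "scaled_icosahedron \<phi> s 12 = (1 / 2) *\<^sub>R vector [0, - s, - s * \<phi>]"
  by (simp_all add: scaled_icosahedron_def)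

lemma inner_vector_3: "(vector [a, b, c] :: real ^ 3) \<bullet> vector [x, y, z] = a * x + b * y + c * z"
  by (simp add: inner_vec_def sum_3)

lemma vector_3_arith:
  "(vector [a, b, c] :: real ^ 3) - vector [x, y, z] = vector [a - x, b - y, c - z]"
  "(vector [a, b, c] :: real ^ 3) + vector [x, y, z] = vector [a + x, b + y, c + z]"
  "q *\<^sub>R (vector [a, b, c] :: real ^ 3) = vector [q * a, q * b, q * c]"
  "(vector [a, b, c] :: real ^ 3) = 0 \<longleftrightarrow> a = 0 \<and> b = 0 \<and> c = 0"
  by (simp_all add: vec_eq_iff forall_3)

lemma ico_edges_not_singleton: "{i, i} \<notin> ico_edges"
proof
  assume "{i, i} \<in> ico_edges"
  then obtain g where g: "g \<in> ico_group" "{i, i} = {g 1, g 2}" unfolding ico_edges_def by auto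
  then have "g 1 = g 2" by (metis doubleton_eq_iff)
  then have "(1 :: vertex) = 2" using ico_group_bij[OF g(1)] by (metis bij_is_inj injD)
  then show False by simp
qed

lemma eq_uminus_imp_zero: "x = - x \<Longrightarrow> x = 0" for x :: "'a :: real_vector"
  by (metis add_eq_0_iff scaleR_2 scaleR_eq_0_iff zero_neq_numeral)

lemma scaled_icosahedron:
  assumes \<phi>: "\<phi>^2 = \<phi> + 1" and s: "s = 1 \<or> s = (4 * \<phi> - 7) / 5"
  defines "V \<equiv> scaled_icosahedron \<phi> s" and "n \<equiv> (2 + \<phi>) / 4"
  shows "norm_profile V n (s^2 * n) 1" "V \<in> central_icosahedra"
proof -
  have \<phi>': "\<phi> * \<phi> = \<phi> + 1" "\<phi> * (\<phi> * x) = \<phi> * x + x" for x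
    using \<phi> by (simp_all add: power2_eq_square distrib_right flip: mult.assoc)
  show profile: "norm_profile V n (s^2 * n) 1"
    unfolding norm_profile_def all_vertex V_def n_def
    by (simp add: scaled_icosahedron_nth vector_3_arith inner_vector_3 power2_eq_square algebra_simps \<phi>')
  have "\<forall>i. V i + V (perm_d i) = 0"
    unfolding all_vertex V_def by (simp add: scaled_icosahedron_nth vector_3_arith)
  then have opposite: "V (perm_d i) = - V i" for i by (simp add: add_eq_0_iff)
  \<comment> \<open>At the edges through 1 or 12, unit length means
    \<open>(\<phi> + 2) * s^2 - 2 * \<phi> * s + \<phi> - 2 = 0\<close>, whose roots are the two
    values of \<open>s\<close>.\<close>
  have edges: "\<forall>e\<in>ico_edges. \<forall>i\<in>e. \<forall>j\<in>e. i \<noteq> j \<longrightarrow> (V i - V j) \<bullet> (V i - V j) = 1"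
    using s
  proof
    assume "s = 1"
    then show ?thesis
      unfolding ico_edges_eq V_def
      by (simp add: scaled_icosahedron_nth vector_3_arith inner_vector_3 power2_eq_square field_simps \<phi>')
  next
    assume s: "s = (4 * \<phi> - 7) / 5"
    show ?thesis
      unfolding ico_edges_eq V_def s
      by (simp add: scaled_icosahedron_nth vector_3_arith inner_vector_3 power2_eq_square field_simps \<phi>')
  qed
  show "V \<in> central_icosahedra"
    unfolding central_icosahedra_def icosahedra_def
  proof (intro CollectI conjI allI impI)
    have "(\<Sum>i\<in>UNIV. V i) = (\<Sum>i\<in>UNIV. V (perm_d i))"
      using sum.reindex_bij_betw[OF bij_generators(4)] by metis
    also have "\<dots> = - (\<Sum>i\<in>UNIV. V i)" by (simp add: opposite sum_negf)
    finally show "(\<Sum>i\<in>UNIV. V i) = 0" by (rule eq_uminus_imp_zero)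
    show "V i + V (perm_d i) = 0" for i by (simp add: opposite)
    \<comment> \<open>For injectivity: nonzero \<open>n\<close> and \<open>s\<close> keep vertices
      off the origin and so opposite vertices apart; \<open>n \<noteq> 1 / 4\<close> separates a
      vertex from the opposites of its neighbours.\<close>
    have "\<phi> \<noteq> - 2" "\<phi> \<noteq> - 1" using \<phi> by auto
    then have "n \<noteq> 0" "n \<noteq> 1 / 4" by (auto simp: n_def)
    have "s \<noteq> 0"
    proof
      assume "s = 0"
      with s have "\<phi> = 7 / 4" by simp
      with \<phi> show False by (simp add: power2_eq_square)
    qed
    have edge: "(V i - V j) \<bullet> (V i - V j) = 1" if "{i, j} \<in> ico_edges" for i j
    proof -
      have "i \<noteq> j" using that ico_edges_not_singleton by metis
      then show ?thesis using edges[rule_format, OF that, of i j] by simp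
    qed
    then show "norm (V i - V j) = 1" if "{i, j} \<in> ico_edges" for i j
      using that by (simp add: norm_eq_1)
    show "inj V"
    proof (rule injI, rule ccontr)
      fix i j assume eq: "V i = V j" and "i \<noteq> j"
      then consider "j = perm_d i" | "{i, j} \<in> ico_edges" | "j \<noteq> perm_d i" "{i, perm_d j} \<in> ico_edges"
        using vertex_pair_cases[of j i] by blast
      then show False
      proof cases
        case 1
        with eq opposite[of i] have "V i = - V i" by simp
        then have "V i = 0" by (rule eq_uminus_imp_zero)
        then have "V i \<bullet> V i = 0" by simp
        with profile \<open>n \<noteq> 0\<close> \<open>s \<noteq> 0\<close> show False unfolding norm_profile_def by (metis mult_eq_0_iff power_not_zero)
      next
        case 2
        with edge[of i j] eq show False by simp
      next
        case 3
        have "(V i + V i) \<bullet> (V i + V i) = 1"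
          using edge[OF 3(2)] by (simp only: opposite diff_minus_eq_add flip: eq)
        then have "V i \<bullet> V i = 1 / 4" by (simp only: inner_add_left inner_add_right)
        \<comment> \<open>\<open>i\<close> and \<open>j\<close> lie on different axes, so at most
          one of them is on the exceptional axis.\<close>
        moreover have "V i \<bullet> V i = n \<or> V j \<bullet> V j = n"
          using profile 3(1) \<open>i \<noteq> j\<close> unfolding norm_profile_def by (metis generators_involution(4))
        ultimately show False using eq \<open>n \<noteq> 1 / 4\<close> by simp
      qed
    qed
  qed
qed

lemma ex_norm_profile:
  assumes "admissible_norms n r"
  shows "\<exists>V\<in>central_icosahedra. norm_profile V n r 1"
proof -
  define \<phi> where "\<phi> = 4 * n - 2"
  have n: "n = (2 + \<phi>) / 4" by (simp add: \<phi>_def)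
  have \<phi>: "\<phi>^2 = \<phi> + 1"
    using assms by (simp add: admissible_norms_def \<phi>_def power2_eq_square algebra_simps)
  have "r = 1^2 * n \<or> r = ((4 * \<phi> - 7) / 5)^2 * n"
  proof -
    \<comment> \<open>Reflection scales the norm by the squared factor, which yields the second
      admissible value of \<open>r\<close>.\<close>
    have "((4 * \<phi> - 7) / 5)^2 * n = 2 - 11 / 5 * n"
      unfolding n using \<phi> by algebra
    then show ?thesis using assms by (auto simp: admissible_norms_def)
  qed
  then obtain s where "s = 1 \<or> s = (4 * \<phi> - 7) / 5" "r = s^2 * n" by blast
  with scaled_icosahedron[OF \<phi>] show ?thesis unfolding n by blast
qed

section \<open>Counting the norm patterns\<close>

lemma norm_profile_unique:
  assumes "norm_profile V n r k" "norm_profile V n' r' k'"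
  shows "n = n' \<and> r = r'"
proof -
  \<comment> \<open>Two axes cover at most four of the twelve vertices, so some vertex has the
    common norm in both profiles.\<close>
  have "card {k, perm_d k, k', perm_d k'} \<le> 4"
    using card_length[of "[k, perm_d k, k', perm_d k']"] by simp
  then have "{k, perm_d k, k', perm_d k'} \<noteq> UNIV" by (auto dest: arg_cong[where f = card])
  then obtain j where "j \<notin> {k, perm_d k, k', perm_d k'}" by blast
  then have "V j \<bullet> V j = n" "V j \<bullet> V j = n'"
    using assms[unfolded norm_profile_def, THEN spec, of j] by auto
  then have "n = n'" by simp
  moreover have "r = r'"
  proof (cases "k = k' \<or> k = perm_d k'")
    case True
    then show ?thesis using assms unfolding norm_profile_def by metis
  next
    case False
    \<comment> \<open>Each exceptional axis is an ordinary one for the other profile.\<close>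
    then have "r = n'" using assms unfolding norm_profile_def by metis
    moreover from False have "k' \<noteq> k" "k' \<noteq> perm_d k" using generators_involution(4) by auto
    then have "r' = n" using assms unfolding norm_profile_def by metis
    ultimately show ?thesis using \<open>n = n'\<close> by simp
  qed
  ultimately show ?thesis ..
qed

lemma card_admissible_norms: "card {(n, r). admissible_norms n r} = 4"
proof -
  define u v :: real where "u = (5 + sqrt 5) / 8" and "v = (5 - sqrt 5) / 8"
  have roots: "16 * n^2 - 20 * n + 5 = 0 \<longleftrightarrow> n = u \<or> n = v" for n
  proof -
    have "16 * n^2 - 20 * n + 5 = 16 * ((n - u) * (n - v))"
      by (simp add: u_def v_def field_simps power2_eq_square)
    then show ?thesis by simp
  qed
  have "{(n, r). admissible_norms n r} =
      {(u, u), (u, 2 - 11 / 5 * u), (v, v), (v, 2 - 11 / 5 * v)}"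
    unfolding admissible_norms_def roots by auto
  moreover have "u \<noteq> v" by (simp add: u_def v_def)
  moreover have "u \<noteq> 2 - 11 / 5 * u" "v \<noteq> 2 - 11 / 5 * v"
  proof -
    \<comment> \<open>\<open>5 / 8\<close> is the only fixed point of
      \<open>x \<mapsto> 2 - 11 / 5 * x\<close>.\<close>
    have "u \<noteq> 5 / 8" "v \<noteq> 5 / 8" by (simp_all add: u_def v_def)
    then show "u \<noteq> 2 - 11 / 5 * u" "v \<noteq> 2 - 11 / 5 * v" by auto
  qed
  ultimately show ?thesis by simp
qed

theorem proposition2:
  shows "card {C \<in> icosahedra // isometry_rel. \<forall>V\<in>C. \<forall>i. V i + V (perm_d i) = 0} = 4"
proof -
  \<comment> \<open>\<open>iso_class\<close> turns out to be a bijection from the admissible pairs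
    onto the classes to be counted.\<close>
  define iso_class where "iso_class = (\<lambda>(n, r). {V \<in> central_icosahedra. \<exists>k. norm_profile V n r k})"
  have class_eq: "isometry_rel `` {V} = iso_class (n, r)"
    if "V \<in> central_icosahedra" "norm_profile V n r k" for V n r k
    using isometric_central[OF that] central_isometric[OF that(1) _ that(2)] by (auto simp: iso_class_def)
  have "{C \<in> icosahedra // isometry_rel. \<forall>V\<in>C. \<forall>i. V i + V (perm_d i) = 0} =
    iso_class ` {(n, r). admissible_norms n r}" (is "?L = ?R")
  proof
    show "?L \<subseteq> ?R"
    proof
      fix C assume C: "C \<in> ?L"
      then obtain V where V: "V \<in> icosahedra" "C = isometry_rel `` {V}" by (auto elim: quotientE)
      \<comment> \<open>Reflexivity puts \<open>V\<close> into \<open>C\<close>, so the condition on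
        the members of \<open>C\<close> applies to \<open>V\<close>.\<close>
      have "(V, V) \<in> isometry_rel" using V(1) ico_group_id
        unfolding isometry_rel_iff by (intro conjI bexI[of _ id]) simp_all
      with C V have "V \<in> central_icosahedra" by (simp add: central_icosahedra_def)
      moreover from this obtain n r k where "admissible_norms n r" "norm_profile V n r k"
        by (rule central_norm_profile)
      ultimately show "C \<in> ?R" using class_eq V(2) by blast
    qed
    show "?R \<subseteq> ?L"
    proof
      fix C assume "C \<in> ?R"
      then obtain n r where "admissible_norms n r" and C: "C = iso_class (n, r)" by blast
      then obtain V where V: "V \<in> central_icosahedra" "norm_profile V n r 1"
        using ex_norm_profile by blast
      then have "C \<in> icosahedra // isometry_rel"
        unfolding C class_eq[OF V, symmetric] by (intro quotientI) (simp add: central_icosahedra_def)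
      then show "C \<in> ?L" by (simp add: C iso_class_def central_icosahedra_def)
    qed
  qed
  moreover have "inj_on iso_class {(n, r). admissible_norms n r}"
  proof (rule inj_onI, clarify)
    fix n r n' r' assume "admissible_norms n r" and eq: "iso_class (n, r) = iso_class (n', r')"
    \<comment> \<open>Classes of admissible pairs are nonempty, and a common member determines the
      parameters.\<close>
    then obtain V where "V \<in> iso_class (n, r)" using ex_norm_profile by (fastforce simp: iso_class_def)
    moreover from this eq have "V \<in> iso_class (n', r')" by simp
    ultimately show "n = n' \<and> r = r'" unfolding iso_class_def using norm_profile_unique by blast
  qed
  ultimately show ?thesis by (simp add: card_image card_admissible_norms)
qed

end
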